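(* Let $S$ be a round and basic $\vee$-semilattice. Then $(\widehat{S}_p)_{p\in S}$ is a basis for the topology of the spectrum $\widehat{S}$.
   Context: A $\vee$-semilattice is a non-empty poset in which any two elements $p,q$ have a supremum $p\vee q$. A grill in a $\vee$-semilattice $S$ is a subset $G\subseteq S$ such that $p\vee q\geq g\in G$ implies $p\in G$ or $q\in G$. The spectrum $\widehat{S}$ is the set of all proper minimal non-empty grills of $S$, i.e. grills $G$ with $\emptyset\neq G\neq S$ such that no non-empty grill is strictly contained in $G$. It carries the topology generated by the subbasis $(\widehat{S}_p)_{p\in S}$, where $\widehat{S}_p=\{G\in\widehat{S}:p\in G\}$. A non-empty finite $F\subseteq S$ is far if for all $p,q\in S$: if $p\leq q\vee f$ for all $f\in F$, then $p\leq q$. The rather below relation is defined by: $p\prec q$ iff for all $s\in S$ with $s\nleq q$ there is a finite $F\subseteq S$ such that $F\cup\{p\}$ is far and $s\leq f\vee q$ for all $f\in F$. $S$ is round if for every $p\in S$ there is $q\in S$ with $p\prec q$. $S$ is basic if for all $p,q,s,t\in S$: $t\prec q\vee s$ and $t\prec p\vee s$ imply that there is $r\in S$ with $r\leq p$, $r\leq q$ and $t\prec r\vee s$. *)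

theory Defs
  imports "HOL-Analysis.Analysis"
begin

text \<open>A join-semilattice is a type of class \<^class>\<open>semilattice_sup\<close>; it is non-empty because every
  type is.\<close>

definition grill :: "'a::semilattice_sup set \<Rightarrow> bool" where
  "grill G \<longleftrightarrow> (\<forall>p q g. g \<in> G \<and> g \<le> sup p q \<longrightarrow> p \<in> G \<or> q \<in> G)"

definition spectrum :: "'a::semilattice_sup set set" where
  "spectrum = {G. grill G \<and> G \<noteq> {} \<and> G \<noteq> UNIV \<and> \<not> (\<exists>H. grill H \<and> H \<noteq> {} \<and> H \<subset> G)}"

definition spectrum_at :: "'a::semilattice_sup \<Rightarrow> 'a set set" where
  "spectrum_at p = {G \<in> spectrum. p \<in> G}"

definition spectrum_topology :: "'a::semilattice_sup set topology" where
  "spectrum_topology = topology_generated_by (range spectrum_at)"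

text \<open>\<^const>\<open>topology_generated_by\<close> takes the union of the subbasis as the whole space. Here this
  is the spectrum, because its members are non-empty.\<close>

lemma topspace_spectrum_topology [simp]: "topspace spectrum_topology = spectrum"
  by (auto simp: spectrum_topology_def topology_generated_by_topspace spectrum_at_def spectrum_def)

definition far :: "'a::semilattice_sup set \<Rightarrow> bool" where
  "far F \<longleftrightarrow> finite F \<and> F \<noteq> {} \<and> (\<forall>p q. (\<forall>f\<in>F. p \<le> sup q f) \<longrightarrow> p \<le> q)"

definition rather_below :: "'a::semilattice_sup \<Rightarrow> 'a \<Rightarrow> bool" where
  "rather_below p q \<longleftrightarrow> (\<forall>s. \<not> s \<le> q \<longrightarrow> (\<exists>F. finite F \<and> far (F \<union> {p}) \<and> (\<forall>f\<in>F. s \<le> sup f q)))"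

definition round_semilattice :: "'a::semilattice_sup itself \<Rightarrow> bool" where
  "round_semilattice _ \<longleftrightarrow> (\<forall>p::'a. \<exists>q. rather_below p q)"

definition basic_semilattice :: "'a::semilattice_sup itself \<Rightarrow> bool" where
  "basic_semilattice _ \<longleftrightarrow> (\<forall>p q s t::'a.
     rather_below t (sup q s) \<and> rather_below t (sup p s) \<longrightarrow> (\<exists>r. r \<le> p \<and> r \<le> q \<and> rather_below t (sup r s)))"

text \<open>The counterpart of \<^const>\<open>topological_basis\<close> for \<^typ>\<open>'a topology\<close>.\<close>

definition topology_basis :: "'a topology \<Rightarrow> 'a set set \<Rightarrow> bool" where
  "topology_basis X B \<longleftrightarrow>
     (\<forall>b\<in>B. openin X b) \<and> (\<forall>U. openin X U \<longrightarrow> (\<exists>B'\<subseteq>B. \<Union>B' = U))"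

end

theory Submission
  imports Defs
begin

text \<open>The complement \<open>I\<close> of a point \<open>G\<close> of the spectrum is a maximal proper non-empty ideal. For
  \<open>p, q \<in> G\<close> maximality yields a single \<open>s \<in> I\<close> with \<open>u \<le> p \<squnion> s\<close> and \<open>u \<le> q \<squnion> s\<close>, where \<open>t \<prec> u\<close> for some
  \<open>t \<in> G\<close> by roundness. Basicness gives \<open>r \<le> p, q\<close> with \<open>t \<prec> r \<squnion> s\<close>. Since \<open>\<prec>\<close> is contained in \<open>\<le>\<close>, the
  grill \<open>G\<close> contains \<open>r \<squnion> s\<close> and hence \<open>r\<close>.\<close>

lemma grill_upward_closed: "grill G \<Longrightarrow> g \<in> G \<Longrightarrow> g \<le> p \<Longrightarrow> p \<in> G"
  unfolding grill_def by (metis sup_idem)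

lemma grill_sup_iff: "grill G \<Longrightarrow> sup p q \<in> G \<longleftrightarrow> p \<in> G \<or> q \<in> G"
  by (meson grill_def grill_upward_closed order_refl sup_ge1 sup_ge2)

text \<open>If \<open>p\<close> were not below \<open>q\<close>, taking \<open>s = p\<close> in the
  definition would give a far set \<open>F \<union> {p}\<close> each of whose members joins with
  \<open>q\<close> to something above \<open>p\<close>; farness then forces
  \<open>p \<le> q\<close>.\<close>

lemma rather_below_imp_le:
  assumes "rather_below p q"
  shows "p \<le> q"
proof (rule ccontr)
  assume "\<not> p \<le> q"
  with assms obtain F where "far (F \<union> {p})" and "\<forall>f\<in>F. p \<le> sup f q"
    unfolding rather_below_def by blast
  moreover from this have "\<forall>f\<in>F \<union> {p}. p \<le> sup q f"
    by (simp add: sup_commute)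
  ultimately have "p \<le> q"
    unfolding far_def by blast
  with \<open>\<not> p \<le> q\<close> show False ..
qed

lemma rather_below_le_trans:
  assumes "rather_below p q" "q \<le> r"
  shows "rather_below p r"
  unfolding rather_below_def
proof (intro allI impI)
  fix s assume "\<not> s \<le> r"
  with \<open>q \<le> r\<close> have "\<not> s \<le> q"
    by (meson order_trans)
  with assms(1) obtain F where "finite F" "far (F \<union> {p})" "\<forall>f\<in>F. s \<le> sup f q"
    unfolding rather_below_def by blast
  \<comment> \<open>The set \<open>F\<close> chosen for \<open>q\<close> also serves for
    \<open>r\<close>, since enlarging \<open>q\<close> only enlarges the joins.\<close>
  moreover have "sup f q \<le> sup f r" for f
    using \<open>q \<le> r\<close> by (simp add: le_supI2)
  ultimately show "\<exists>F. finite F \<and> far (F \<union> {p}) \<and> (\<forall>f\<in>F. s \<le> sup f r)"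
    by (meson order_trans)
qed

text \<open>Minimality of \<open>G\<close> makes its complement a maximal ideal, so adjoining
  \<open>p \<in> G\<close> generates all of \<open>S\<close>; hence \<open>u\<close> is
  arbitrary.\<close>

lemma spectrum_cover:
  assumes "G \<in> spectrum" "p \<in> G"
  obtains i where "i \<notin> G" "u \<le> sup p i"
proof -
  \<comment> \<open>The complement of the ideal generated by \<open>p\<close> and the complement of
    \<open>G\<close>.\<close>
  let ?H = "{x. \<forall>i. i \<notin> G \<longrightarrow> \<not> x \<le> sup p i}"
  have G: "grill G" "G \<noteq> UNIV"
    and minimal: "\<And>H. grill H \<Longrightarrow> H \<subset> G \<Longrightarrow> H = {}"
    using assms(1) unfolding spectrum_def by auto
  have "grill ?H"
    unfolding grill_def
  proof (intro allI impI, elim conjE, rule ccontr)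
    fix a b g
    assume g: "g \<in> ?H" "g \<le> sup a b" and "\<not> (a \<in> ?H \<or> b \<in> ?H)"
    then obtain i j where ij: "i \<notin> G" "j \<notin> G" "a \<le> sup p i" "b \<le> sup p j"
      by auto
    have "g \<le> sup a b" by (fact g(2))
    also have "\<dots> \<le> sup (sup p i) (sup p j)"
      using ij by (intro sup.mono)
    also have "\<dots> = sup p (sup i j)"
      by (simp add: ac_simps)
    finally have "g \<le> sup p (sup i j)" .
    moreover have "sup i j \<notin> G"
      using ij G by (simp add: grill_sup_iff)
    ultimately show False
      using g(1) by blast
  qed
  \<comment> \<open>An \<open>x\<close> outside \<open>G\<close> is excluded from \<open>?H\<close>
    by \<open>i = x\<close>. The element \<open>p\<close> is excluded by any \<open>i\<close>
    outside \<open>G\<close>, and such an \<open>i\<close> exists because \<open>G\<close> is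
    proper.\<close>
  moreover have "?H \<subset> G"
  proof -
    have "?H \<subseteq> G"
      using sup_ge2 by blast
    moreover have "p \<notin> ?H"
      using G(2) by auto
    ultimately show ?thesis
      using assms(2) by blast
  qed
  ultimately have "?H = {}"
    by (rule minimal)
  then show thesis
    using that by blast
qed

lemma spectrum_at_mono: "p \<le> q \<Longrightarrow> spectrum_at p \<subseteq> spectrum_at q"
  by (auto simp: spectrum_at_def spectrum_def intro: grill_upward_closed)

text \<open>This turns intersections of subbasic neighbourhoods of \<open>G\<close> into subbasic
  ones. The element \<open>p\<close> itself serves as the \<open>t\<close> of basicness.\<close>

lemma spectrum_directed:
  fixes G :: "'a::semilattice_sup set"
  assumes "round_semilattice TYPE('a)" "basic_semilattice TYPE('a)"
    and "G \<in> spectrum" "p \<in> G" "q \<in> G"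
  obtains r where "r \<in> G" "r \<le> p" "r \<le> q"
proof -
  have G: "grill G"
    using assms(3) by (simp add: spectrum_def)
  obtain u where u: "rather_below p u"
    using assms(1) unfolding round_semilattice_def by blast
  obtain i where i: "i \<notin> G" "u \<le> sup p i"
    using spectrum_cover assms by blast
  obtain j where j: "j \<notin> G" "u \<le> sup q j"
    using spectrum_cover assms by blast
  \<comment> \<open>Basicness requires the same \<open>s\<close> on both sides;
    \<open>sup i j\<close> works and still lies outside the grill \<open>G\<close>.\<close>
  have "u \<le> sup p (sup i j)" "u \<le> sup q (sup i j)"
    using order_trans[OF i(2) sup.mono] order_trans[OF j(2) sup.mono] by simp_all
  then have "rather_below p (sup p (sup i j))" "rather_below p (sup q (sup i j))"
    using u rather_below_le_trans by blast+
  then obtain r where r: "r \<le> p" "r \<le> q" "rather_below p (sup r (sup i j))"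
    using assms(2) unfolding basic_semilattice_def by blast
  have "sup r (sup i j) \<in> G"
    using r(3) G assms(4) rather_below_imp_le grill_upward_closed by blast
  then have "r \<in> G"
    using i j G by (simp add: grill_sup_iff)
  with r that show thesis by blast
qed

text \<open>Induction on the generation of open sets: binary intersections use
  \<open>spectrum_directed\<close>, and a union inherits the neighbourhood from a member containing
  \<open>G\<close>.\<close>

lemma openin_spectrum_topology_imp_spectrum_at:
  fixes U :: "'a::semilattice_sup set set"
  assumes "round_semilattice TYPE('a)" "basic_semilattice TYPE('a)"
    and "openin spectrum_topology U" "G \<in> U"
  shows "\<exists>p. G \<in> spectrum_at p \<and> spectrum_at p \<subseteq> U"
proof -
  have "generate_topology_on (range spectrum_at) U"
    using assms(3) by (simp add: spectrum_topology_def openin_topology_generated_by_iff)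
  then show ?thesis
    using assms(4)
  proof (induction arbitrary: G)
    case (Int U V)
    obtain p where p: "G \<in> spectrum_at p" "spectrum_at p \<subseteq> U"
      using Int.IH(1) Int.prems by auto
    obtain q where q: "G \<in> spectrum_at q" "spectrum_at q \<subseteq> V"
      using Int.IH(2) Int.prems by auto
    have G: "G \<in> spectrum" "p \<in> G" "q \<in> G"
      using p(1) q(1) by (simp_all add: spectrum_at_def)
    obtain r where r: "r \<in> G" "r \<le> p" "r \<le> q"
      using spectrum_directed[OF assms(1,2) G] .
    have "spectrum_at r \<subseteq> U \<inter> V"
      using r(2,3)[THEN spectrum_at_mono] p(2) q(2) by auto
    moreover have "G \<in> spectrum_at r"
      using G(1) r(1) by (simp add: spectrum_at_def)
    ultimately show ?case
      by (intro exI conjI)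
  next
    case (UN K)
    then obtain k where k: "k \<in> K" "G \<in> k"
      by auto
    with UN.IH obtain p where "G \<in> spectrum_at p" "spectrum_at p \<subseteq> k"
      by metis
    with k(1) show ?case
      by (intro exI[of _ p]) auto
  qed auto
qed

theorem proposition6p3:
  assumes "round_semilattice TYPE('a::semilattice_sup)"
    and "basic_semilattice TYPE('a)"
  shows "topology_basis (spectrum_topology :: 'a set topology) (range spectrum_at)"
  unfolding topology_basis_def
proof (intro conjI ballI allI impI)
  fix b :: "'a set set"
  assume "b \<in> range spectrum_at"
  then show "openin spectrum_topology b"
    unfolding spectrum_topology_def by (rule topology_generated_by_Basis)
next
  fix U :: "'a set set"
  assume "openin spectrum_topology U"
  then have "\<exists>p. G \<in> spectrum_at p \<and> spectrum_at p \<subseteq> U" if "G \<in> U" for G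
    using openin_spectrum_topology_imp_spectrum_at[OF assms] that by simp
  then have "\<Union>{b \<in> range spectrum_at. b \<subseteq> U} = U"
    by fastforce
  then show "\<exists>B'\<subseteq>range spectrum_at. \<Union>B' = U"
    by (intro exI[of _ "{b \<in> range spectrum_at. b \<subseteq> U}"] conjI) auto
qed

end
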